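(* Let $r\geq 4$ be an integer and let $G$ be a graph containing no subgraph isomorphic to the complete graph $K_r$, with maximum degree $\Delta\geq 3$. Then $\chi_{\ell}(G)\leq 200r \frac{\Delta\ln\ln\Delta}{\ln \Delta}$.
   Context: The list chromatic number $\chi_\ell(G)$ of a graph $G$ is the smallest integer $q$ such that for every assignment of a list of $q$ colours to each vertex of $G$, there is a proper colouring of $G$ in which every vertex receives a colour from its own list. *)

theory Defs
  imports "HOL-Analysis.Analysis" "Graph_Theory.Graph_Theory"
begin

text \<open>
  Finite simple graphs are the loop-free symmetric digraphs without multiple arcs described by the
  locale \<^locale>\<open>graph\<close>. An edge is a pair of opposite arcs, so the degree of a vertex is its
  out-degree.
\<close>

definition max_degree :: "('a,'b) pre_digraph \<Rightarrow> nat" where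
  "max_degree G = Max (insert 0 (out_degree G ` verts G))"

definition proper_colouring :: "('a,'b) pre_digraph \<Rightarrow> ('a \<Rightarrow> 'c) \<Rightarrow> bool" where
  "proper_colouring G f \<longleftrightarrow> (\<forall>u v. u \<rightarrow>\<^bsub>G\<^esub> v \<longrightarrow> f u \<noteq> f v)"

definition list_colouring :: "('a,'b) pre_digraph \<Rightarrow> ('a \<Rightarrow> 'c set) \<Rightarrow> ('a \<Rightarrow> 'c) \<Rightarrow> bool" where
  "list_colouring G L f \<longleftrightarrow> proper_colouring G f \<and> (\<forall>v\<in>verts G. f v \<in> L v)"

text \<open>
  Colours are natural numbers; by \<open>choosable_any_colours\<close> below this is no restriction for finite
  graphs. The condition \<^const>\<open>finite\<close> only matters for \<open>q = 0\<close>.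
\<close>

definition choosable :: "nat \<Rightarrow> ('a,'b) pre_digraph \<Rightarrow> bool" where
  "choosable q G \<longleftrightarrow>
     (\<forall>L :: 'a \<Rightarrow> nat set. (\<forall>v\<in>verts G. finite (L v) \<and> card (L v) = q) \<longrightarrow>
        (\<exists>f. list_colouring G L f))"

definition list_chromatic_number :: "('a,'b) pre_digraph \<Rightarrow> nat" where
  "list_chromatic_number G = (LEAST q. choosable q G)"

lemma (in wf_digraph) choosable_any_colours:
  fixes L :: "'a \<Rightarrow> 'c set"
  assumes fin: "finite (verts G)" and ch: "choosable q G"
    and L: "\<And>v. v \<in> verts G \<Longrightarrow> finite (L v) \<and> card (L v) = q"
  shows "\<exists>f. list_colouring G L f"
proof -
  let ?U = "\<Union>v\<in>verts G. L v"
  have "finite ?U" using fin L by simp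
  then obtain e :: "'c \<Rightarrow> nat" where e: "inj_on e ?U"
    using finite_imp_inj_to_nat_seg[of ?U] by blast
  have inj: "inj_on e (L v)" if "v \<in> verts G" for v
    using e UN_upper[OF that] by (rule inj_on_subset)
  have "\<forall>v\<in>verts G. finite (e ` L v) \<and> card (e ` L v) = q"
    using L card_image[OF inj] by simp
  with ch[unfolded choosable_def, rule_format, of "\<lambda>v. e ` L v"]
  obtain f where f: "list_colouring G (\<lambda>v. e ` L v) f" by auto
  have bk: "inv_into (L v) e (f v) \<in> L v \<and> e (inv_into (L v) e (f v)) = f v"
    if "v \<in> verts G" for v
  proof -
    have "f v \<in> e ` L v" using f that unfolding list_colouring_def by blast
    then show ?thesis by (simp add: inv_into_into f_inv_into_f)
  qed
  have "proper_colouring G (\<lambda>v. inv_into (L v) e (f v))"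
    unfolding proper_colouring_def
  proof (intro allI impI)
    fix u v assume uv: "u \<rightarrow>\<^bsub>G\<^esub> v"
    have uv_verts: "u \<in> verts G" "v \<in> verts G" using adj_in_verts[OF uv] by simp_all
    have "f u \<noteq> f v"
      using f uv unfolding list_colouring_def proper_colouring_def by blast
    then show "inv_into (L u) e (f u) \<noteq> inv_into (L v) e (f v)"
      using bk[OF uv_verts(1)] bk[OF uv_verts(2)] by auto
  qed
  then have "list_colouring G L (\<lambda>v. inv_into (L v) e (f v))"
    using bk unfolding list_colouring_def by simp
  then show ?thesis by blast
qed

lemma (in digraph) choosable_card_verts: "choosable (card (verts G)) G"
  unfolding choosable_def
proof (intro allI impI)
  fix L :: "'a \<Rightarrow> nat set"
  assume L: "\<forall>v\<in>verts G. finite (L v) \<and> card (L v) = card (verts G)"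
  have "\<exists>f. inj_on f S \<and> (\<forall>v\<in>S. f v \<in> L v)" if "finite S" "S \<subseteq> verts G" for S
    using that
  proof (induction S rule: finite_induct)
    case empty
    then show ?case by simp
  next
    case (insert x S)
    have "S \<subseteq> verts G" and x: "x \<in> verts G" using insert.prems by auto
    then obtain f where f: "inj_on f S" "\<forall>v\<in>S. f v \<in> L v" using insert.IH by blast
    have "card (f ` S) \<le> card S" using insert.hyps(1) by (rule card_image_le)
    also have "\<dots> < card (insert x S)" using insert.hyps by simp
    also have "\<dots> \<le> card (verts G)" using finite_verts insert.prems by (rule card_mono)
    also have "\<dots> = card (L x)" using L x by simp
    finally have "card (f ` S) < card (L x)" .
    then have "\<not> L x \<subseteq> f ` S" using card_mono[OF finite_imageI[OF insert.hyps(1), of f], of "L x"]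
      by linarith
    then obtain c where "c \<in> L x" "c \<notin> f ` S" by blast
    have "inj_on (f(x := c)) (insert x S)"
    proof (rule inj_onI)
      fix u v assume "u \<in> insert x S" "v \<in> insert x S" "(f(x := c)) u = (f(x := c)) v"
      then show "u = v"
        using \<open>c \<notin> f ` S\<close> inj_onD[OF f(1), of u v]
        by (cases "u = x"; cases "v = x") auto
    qed
    moreover have "\<forall>v\<in>insert x S. (f(x := c)) v \<in> L v"
      using f(2) \<open>c \<in> L x\<close> by simp
    ultimately show ?case by blast
  qed
  from this[OF finite_verts subset_refl]
  obtain f where f: "inj_on f (verts G)" "\<forall>v\<in>verts G. f v \<in> L v" by blast
  have "proper_colouring G f"
    unfolding proper_colouring_def
  proof (intro allI impI)
    fix u v assume uv: "u \<rightarrow>\<^bsub>G\<^esub> v"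
    then have "u \<in> verts G" "v \<in> verts G" "u \<noteq> v"
      using adj_not_same[of u] by auto
    then show "f u \<noteq> f v" using inj_onD[OF f(1), of u v] by blast
  qed
  then show "\<exists>f. list_colouring G L f" using f(2) unfolding list_colouring_def by blast
qed

lemma (in digraph) choosable_list_chromatic_number: "choosable (list_chromatic_number G) G"
  unfolding list_chromatic_number_def
  using LeastI[of "\<lambda>q. choosable q G", OF choosable_card_verts] .

end

theory Submission
  imports Defs
begin

text \<open>
  Rosenfeld's counting method: writing $P(H)$ for the number of list colourings of the subgraph
  induced by $H$, one shows $P(H \cup \{v\}) \ge \ell P(H)$ with $\ell = \Delta^{1/3}$ by
  induction on $H$. By the induction hypothesis, in a uniformly random colouring of $H$ a given
  neighbour of $v$ has only one available colour with probability at most $1/\ell$. Fix a colour $c$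
  such that every neighbour of $v$ coloured $c$ has another available colour. Recolouring these
  neighbours by a fixed choice of alternatives groups the colourings into classes, and each class is
  parametrised by the independent sets of a $K_r$-free graph: the set is the colour class of $c$,
  and the empty set is the only member in which $c$ is free for $v$. A $K_r$-free graph with more
  than $\Delta^{1/3}$ independent sets has independent sets of average size of order
  $\ln \Delta / (r \ln\ln \Delta)$, by Ramsey's theorem, whereas the colour classes
  have only $\Delta$ vertices altogether. Hence many colours are free for $v$.
\<close>

section \<open>Independent sets in graphs without large cliques\<close>

definition indep_sets :: "('a \<Rightarrow> 'a \<Rightarrow> bool) \<Rightarrow> 'a set \<Rightarrow> 'a set set" where
  "indep_sets E S = {A. A \<subseteq> S \<and> (\<forall>x\<in>A. \<forall>y\<in>A. \<not> E x y)}"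

lemma finite_indep_sets: "finite S \<Longrightarrow> finite (indep_sets E S)"
  unfolding indep_sets_def by (rule finite_subset[of _ "Pow S"]) auto

text \<open>A maximum independent set \<open>I\<close> dominates \<open>S\<close>, so at most
  \<open>a\<close> closed neighbourhoods cover \<open>S\<close>, and each neighbourhood excludes
  cliques one vertex smaller. Counting \<open>card S + 1\<close> makes the induction close: it
  bounds closed neighbourhoods, and \<open>a * (a + 1) ^ s + (a + 1) ^ s\<close> is the next
  power.\<close>

lemma Ramsey_clique_indep:
  assumes sym: "\<And>x y. E x y \<Longrightarrow> E y x" and irr: "\<And>x. \<not> E x x"
    and "finite S"
    and "\<And>C. C \<subseteq> S \<Longrightarrow> card C = Suc s \<Longrightarrow> \<exists>x\<in>C. \<exists>y\<in>C. x \<noteq> y \<and> \<not> E x y"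
    and "\<And>A. A \<in> indep_sets E S \<Longrightarrow> card A \<le> a"
  shows "card S + 1 \<le> (a + 1) ^ s"
  using assms(3-)
proof (induction s arbitrary: S)
  case 0
  have "S = {}"
  proof (rule ccontr)
    assume "S \<noteq> {}"
    then obtain x where "x \<in> S" by blast
    then show False using 0(2)[of "{x}"] by auto
  qed
  then show ?case by simp
next
  case (Suc s)
  let ?N = "\<lambda>x. {y \<in> S. E x y}"
  have ne: "{} \<in> indep_sets E S" by (auto simp: indep_sets_def)
  obtain I where I: "I \<in> indep_sets E S" and Imax: "\<And>A. A \<in> indep_sets E S \<Longrightarrow> card A \<le> card I"
  proof -
    have fin: "finite (card ` indep_sets E S)" using finite_indep_sets Suc.prems(1) by blast
    have "Max (card ` indep_sets E S) \<in> card ` indep_sets E S"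
      using fin ne by (intro Max_in) auto
    then obtain I where "I \<in> indep_sets E S" "card I = Max (card ` indep_sets E S)" by auto
    then show thesis using that[of I] fin by simp
  qed
  have IS: "I \<subseteq> S" and finI: "finite I"
    using I Suc.prems(1) by (auto simp: indep_sets_def intro: finite_subset)
  have cover: "S \<subseteq> (\<Union>x\<in>I. insert x (?N x))"
  proof
    fix y assume y: "y \<in> S"
    show "y \<in> (\<Union>x\<in>I. insert x (?N x))"
    proof (rule ccontr)
      assume n: "y \<notin> (\<Union>x\<in>I. insert x (?N x))"
      then have "y \<notin> I" "\<And>x. x \<in> I \<Longrightarrow> \<not> E x y" using y by auto
      then have "insert y I \<in> indep_sets E S"
        using I y irr sym unfolding indep_sets_def by blast
      then show False using Imax[of "insert y I"] \<open>y \<notin> I\<close> finI by simp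
    qed
  qed
  have nb: "card (insert x (?N x)) \<le> (a + 1) ^ s" if x: "x \<in> I" for x
  proof -
    have "card (?N x) + 1 \<le> (a + 1) ^ s"
    proof (rule Suc.IH)
      show "finite (?N x)" using Suc.prems(1) by simp
      show "\<exists>y\<in>C. \<exists>z\<in>C. y \<noteq> z \<and> \<not> E y z" if C: "C \<subseteq> ?N x" "card C = Suc s" for C
      proof -
        have "x \<notin> C" using C irr by auto
        moreover have "finite C" using C(2) card_gt_0_iff by fastforce
        ultimately have "card (insert x C) = Suc (Suc s)" using C by simp
        moreover have "insert x C \<subseteq> S" using C x IS by auto
        ultimately obtain y z where "y \<in> insert x C" "z \<in> insert x C" "y \<noteq> z" "\<not> E y z"
          using Suc.prems(2) by meson
        moreover have "E x w" "E w x" if "w \<in> C" for w using that C sym by auto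
        ultimately show ?thesis by blast
      qed
      show "card A \<le> a" if "A \<in> indep_sets E (?N x)" for A
        using that Suc.prems(3)[of A] unfolding indep_sets_def by auto
    qed
    then show ?thesis using irr Suc.prems(1) by simp
  qed
  have "card S \<le> card (\<Union>x\<in>I. insert x (?N x))"
    using cover finI Suc.prems(1) by (intro card_mono) auto
  also have "\<dots> \<le> (\<Sum>x\<in>I. card (insert x (?N x)))" by (rule card_UN_le[OF finI])
  also have "\<dots> \<le> card I * (a + 1) ^ s" using sum_bounded_above[OF nb, of I] by simp
  also have "\<dots> \<le> a * (a + 1) ^ s" using Suc.prems(3)[OF I] by simp
  finally have "card S \<le> a * (a + 1) ^ s" .
  moreover have "1 \<le> (a + 1) ^ s" by simp
  ultimately have "card S + 1 \<le> a * (a + 1) ^ s + (a + 1) ^ s" by linarith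
  then show ?case by (simp add: algebra_simps)
qed

text \<open>A set of at most \<open>k\<close> elements arises from \<open>k\<close> successive
  choices, each an element of \<open>S\<close> or \<open>None\<close> for adding nothing.\<close>

lemma card_small_subsets_le:
  assumes "finite S"
  shows "card {A. A \<subseteq> S \<and> card A \<le> k} \<le> (card S + 1) ^ k"
proof (induction k)
  case 0
  have "{A. A \<subseteq> S \<and> card A \<le> 0} = {{}}" using assms finite_subset by fastforce
  then show ?case by simp
next
  case (Suc k)
  let ?F = "\<lambda>k. {A. A \<subseteq> S \<and> card A \<le> k}"
  let ?g = "\<lambda>(x, A). case x of None \<Rightarrow> A | Some y \<Rightarrow> insert y A"
  let ?D = "insert None (Some ` S) \<times> ?F k"
  have fin: "finite ?D" using assms by simp
  have "?F (Suc k) \<subseteq> ?g ` ?D"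
  proof
    fix A assume A: "A \<in> ?F (Suc k)"
    then have finA: "finite A" using assms finite_subset by auto
    show "A \<in> ?g ` ?D"
    proof (cases "A = {}")
      case True
      then show ?thesis by (intro image_eqI[of _ _ "(None, {})"]) auto
    next
      case False
      then obtain x where x: "x \<in> A" by blast
      then show ?thesis using A finA
        by (intro image_eqI[of _ _ "(Some x, A - {x})"]) (auto simp: card_Diff_singleton)
    qed
  qed
  then have "card (?F (Suc k)) \<le> card ?D"
    using fin card_image_le card_mono finite_imageI by (meson le_trans)
  also have "\<dots> = (card S + 1) * card (?F k)"
    using assms by (simp add: card_cartesian_product card_image)
  also have "\<dots> \<le> (card S + 1) * (card S + 1) ^ k" using Suc by (intro mult_le_mono) auto
  finally show ?case by simp
qed

text \<open>All subsets of a largest independent set are independent, so its size is at most the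
  binary logarithm of the number of independent sets; Ramsey then bounds \<open>card S\<close>.
  Hence, once there are at least \<open>M\<close> independent sets, half of them have more than
  \<open>k\<close> elements. The summand \<open>M\<close> absorbs the other case, giving one linear
  inequality that can be summed over classes of colourings.\<close>

lemma card_indep_sets_le:
  fixes M :: real
  assumes sym: "\<And>x y. E x y \<Longrightarrow> E y x" and irr: "\<And>x. \<not> E x x"
    and S: "finite S"
    and clique: "\<And>C. C \<subseteq> S \<Longrightarrow> card C = Suc s \<Longrightarrow> \<exists>x\<in>C. \<exists>y\<in>C. x \<noteq> y \<and> \<not> E x y"
    and M: "\<And>z. z \<ge> M \<Longrightarrow> 2 * (1 + log 2 z) ^ (s * k) \<le> z" "M \<ge> 0"
  shows "card (indep_sets E S) \<le> M + 2 / (k + 1) * (\<Sum>A\<in>indep_sets E S. real (card A))"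
proof (cases "card (indep_sets E S) \<ge> M")
  case False
  then show ?thesis by (smt (verit) divide_nonneg_nonneg mult_nonneg_nonneg of_nat_0_le_iff sum_nonneg)
next
  case True
  let ?I = "indep_sets E S"
  let ?z = "real (card ?I)"
  have fin: "finite ?I" by (rule finite_indep_sets[OF S])
  have ne: "{} \<in> ?I" by (auto simp: indep_sets_def)
  define a where "a = Max (card ` ?I)"
  have amax: "card A \<le> a" if "A \<in> ?I" for A unfolding a_def using fin that by simp
  have "a \<in> card ` ?I" unfolding a_def using fin ne by (intro Max_in) auto
  then obtain B where B: "B \<in> ?I" "card B = a" by blast
  have "Pow B \<subseteq> ?I" using B(1) unfolding indep_sets_def by blast
  then have "card (Pow B) \<le> card ?I" by (rule card_mono[OF fin])
  moreover have "finite B" using B(1) S by (auto simp: indep_sets_def intro: finite_subset)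
  ultimately have "2 ^ a \<le> card ?I" using B(2) by (simp add: card_Pow)
  then have "2 ^ a \<le> ?z" by (metis of_nat_le_iff of_nat_numeral of_nat_power)
  then have a: "a \<le> log 2 ?z" by (simp add: le_log2_of_power)
  \<comment> \<open>There are too few sets of size at most \<open>k\<close> to make up half of the independent sets.\<close>
  let ?small = "{A \<in> ?I. card A \<le> k}"
  have "card ?small \<le> card {A. A \<subseteq> S \<and> card A \<le> k}"
    by (rule card_mono) (use S in \<open>auto simp: indep_sets_def\<close>)
  also have "\<dots> \<le> (card S + 1) ^ k" by (rule card_small_subsets_le[OF S])
  also have "\<dots> \<le> ((a + 1) ^ s) ^ k"
    by (intro power_mono Ramsey_clique_indep[OF sym irr S clique amax]) auto
  finally have "card ?small \<le> (a + 1) ^ (s * k)" by (simp only: power_mult)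
  then have "real (card ?small) \<le> real ((a + 1) ^ (s * k))" by (rule of_nat_mono)
  also have "\<dots> = (1 + real a) ^ (s * k)" by (simp add: add.commute)
  also have "\<dots> \<le> (1 + log 2 ?z) ^ (s * k)" using a by (intro power_mono) auto
  finally have small: "2 * real (card ?small) \<le> ?z" using M(1)[OF True] by linarith
  have "(k + 1) * (?z - card ?small) = (\<Sum>A\<in>?I - ?small. real (k + 1))"
    using fin by (simp add: card_Diff_subset of_nat_diff card_mono)
  also have "\<dots> \<le> (\<Sum>A\<in>?I - ?small. real (card A))" by (intro sum_mono) auto
  also have "\<dots> \<le> (\<Sum>A\<in>?I. real (card A))" using fin by (intro sum_mono2) auto
  finally have 1: "(k + 1) * (?z - card ?small) \<le> (\<Sum>A\<in>?I. real (card A))" .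
  have "(k + 1) * (?z / 2) \<le> (k + 1) * (?z - card ?small)" using small by (intro mult_left_mono) auto
  with 1 have "(k + 1) * (?z / 2) \<le> (\<Sum>A\<in>?I. real (card A))" by linarith
  then have "?z \<le> 2 / (k + 1) * (\<Sum>A\<in>?I. real (card A))" by (simp add: field_simps)
  then show ?thesis using M(2) by (simp add: add.commute)
qed

section \<open>Counting list colourings of induced subgraphs\<close>

lemma sum_card_swap:
  assumes "finite A" "finite B"
  shows "(\<Sum>x\<in>A. card {y \<in> B. R x y}) = (\<Sum>y\<in>B. card {x \<in> A. R x y})"
  unfolding card_eq_sum by (rule sum.swap_restrict[OF assms])

locale list_assignment =
  fixes E :: "'a \<Rightarrow> 'a \<Rightarrow> bool" and L :: "'a \<Rightarrow> 'c set"
  assumes sym: "E x y \<Longrightarrow> E y x" and irr: "\<not> E x x"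
    and finite_list: "finite (L v)"
begin

text \<open>Extensional functions are used so that cardinality counts colourings of
  \<open>H\<close>; the empty \<open>H\<close> has exactly one.\<close>

definition colourings :: "'a set \<Rightarrow> ('a \<Rightarrow> 'c) set" where
  "colourings H = {f \<in> Pi\<^sub>E H L. \<forall>x\<in>H. \<forall>y\<in>H. E x y \<longrightarrow> f x \<noteq> f y}"

text \<open>Serves both for extending \<open>f\<close> to a vertex outside \<open>H\<close> and for
  recolouring one inside: as \<open>E\<close> is irreflexive, the present colour of \<open>v\<close>
  does not block itself.\<close>

definition avail :: "'a set \<Rightarrow> ('a \<Rightarrow> 'c) \<Rightarrow> 'a \<Rightarrow> 'c set" where
  "avail H f v = {c \<in> L v. \<forall>u\<in>H. E v u \<longrightarrow> f u \<noteq> c}"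

lemma finite_colourings: "finite H \<Longrightarrow> finite (colourings H)"
  unfolding colourings_def using finite_PiE[of H L] finite_list by simp

lemma finite_avail: "finite (avail H f v)"
  unfolding avail_def using finite_list by simp

lemma avail_self: "f \<in> colourings H \<Longrightarrow> u \<in> H \<Longrightarrow> f u \<in> avail H f u"
  unfolding colourings_def avail_def using sym by fastforce

lemma avail_cong: "(\<And>w. w \<in> H \<Longrightarrow> E u w \<Longrightarrow> f w = g w) \<Longrightarrow> avail H f u = avail H g u"
  unfolding avail_def by auto

lemma card_colourings_insert:
  assumes "finite H" "v \<notin> H"
  shows "card (colourings (insert v H)) = (\<Sum>f\<in>colourings H. card (avail H f v))"
proof -
  have "bij_betw (\<lambda>(f, c). f(v := c)) (Sigma (colourings H) (\<lambda>f. avail H f v)) (colourings (insert v H))"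
  proof (rule bij_betw_byWitness[where f' = "\<lambda>g. (g(v := undefined), g v)"])
    show "\<forall>p\<in>Sigma (colourings H) (\<lambda>f. avail H f v).
        (((\<lambda>(f, c). f(v := c)) p)(v := undefined), ((\<lambda>(f, c). f(v := c)) p) v) = p"
      using assms(2) by (auto simp: colourings_def PiE_def extensional_def)
    show "\<forall>g\<in>colourings (insert v H).
        (\<lambda>(f, c). f(v := c)) (g(v := undefined), g v) = g"
      by simp
    show "(\<lambda>(f, c). f(v := c)) ` Sigma (colourings H) (\<lambda>f. avail H f v) \<subseteq> colourings (insert v H)"
    proof clarify
      fix f c assume f: "f \<in> colourings H" and c: "c \<in> avail H f v"
      have "f(v := c) \<in> Pi\<^sub>E (insert v H) L"
        using f c by (auto simp: colourings_def avail_def PiE_def extensional_def)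
      moreover have "\<forall>y\<in>H. (E v y \<longrightarrow> f y \<noteq> c) \<and> (E y v \<longrightarrow> f y \<noteq> c)"
        using c sym[of _ v] unfolding avail_def by blast
      ultimately show "f(v := c) \<in> colourings (insert v H)"
        using f assms(2) irr[of v] unfolding colourings_def by auto
    qed
    show "(\<lambda>g. (g(v := undefined), g v)) ` colourings (insert v H) \<subseteq> Sigma (colourings H) (\<lambda>f. avail H f v)"
    proof clarify
      fix g assume g: "g \<in> colourings (insert v H)"
      have "g(v := undefined) \<in> Pi\<^sub>E H L"
        using g assms(2) by (auto simp: colourings_def PiE_def extensional_def)
      then have "g(v := undefined) \<in> colourings H"
        using g assms(2) by (auto simp: colourings_def)
      moreover have "g v \<in> avail H (g(v := undefined)) v"
      proof -
        have "g v \<in> L v" "\<And>u. u \<in> H \<Longrightarrow> E v u \<Longrightarrow> g u \<noteq> g v"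
          using g unfolding colourings_def by auto
        then show ?thesis using assms(2) unfolding avail_def by (auto split: if_splits)
      qed
      ultimately show "g(v := undefined) \<in> colourings H \<and> g v \<in> avail H (g(v := undefined)) v"
        by blast
    qed
  qed
  then have "card (colourings (insert v H)) = card (Sigma (colourings H) (\<lambda>f. avail H f v))"
    by (simp add: bij_betw_same_card)
  then show ?thesis
    using finite_colourings[OF assms(1)] finite_avail by simp
qed

text \<open>If \<open>u\<close> has a single available colour, the other vertices force it, so
  erasing the colour of \<open>u\<close> loses nothing. With the growth hypothesis for
  \<open>H - {u}\<close> this makes frozen vertices rare.\<close>

lemma card_frozen_le:
  assumes "finite H" "u \<in> H"
  shows "card {f \<in> colourings H. card (avail H f u) \<le> 1} \<le> card (colourings (H - {u}))"
proof (rule card_inj_on_le[where f = "\<lambda>f. f(u := undefined)"])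
  show "inj_on (\<lambda>f. f(u := undefined)) {f \<in> colourings H. card (avail H f u) \<le> 1}"
  proof (rule inj_onI, clarify)
    fix f g
    assume f: "f \<in> colourings H" "card (avail H f u) \<le> 1"
      and g: "g \<in> colourings H" "card (avail H g u) \<le> 1"
      and eq: "f(u := undefined) = g(u := undefined)"
    have fg: "f w = g w" if "w \<noteq> u" for w using eq that by (metis fun_upd_other)
    then have "avail H f u = avail H g u" using irr by (intro avail_cong) metis
    then have "f u \<in> avail H f u" "g u \<in> avail H f u" using avail_self f(1) g(1) assms(2) by auto
    then have "f u = g u" using f(2) finite_avail[of H f u]
      by (metis One_nat_def card_le_Suc0_iff_eq)
    then show "f = g" using fg by (metis ext)
  qed
  show "(\<lambda>f. f(u := undefined)) ` {f \<in> colourings H. card (avail H f u) \<le> 1} \<subseteq> colourings (H - {u})"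
    by (auto simp: colourings_def PiE_def extensional_def Pi_def)
  show "finite (colourings (H - {u}))" using assms(1) finite_colourings by simp
qed


text \<open>
  The alternative colour of \<open>u\<close> depends only on the available colours of \<open>u\<close>, which do not change
  when the independent set of neighbours coloured \<open>c\<close> is recoloured; this makes the switch invertible.
\<close>

lemma card_switch_colour_le:
  fixes M K :: real
  assumes H: "finite H" and NH: "N \<subseteq> H"
    and indep: "\<And>S. S \<subseteq> N \<Longrightarrow> card (indep_sets E S) \<le> M + K * (\<Sum>A\<in>indep_sets E S. real (card A))"
    and good: "good = {f \<in> colourings H. \<forall>u\<in>N. f u = c \<longrightarrow> \<not> card (avail H f u) \<le> 1}"
  shows "card good \<le> M * card {f \<in> colourings H. c \<notin> f ` N}
      + K * (\<Sum>f\<in>good. real (card {u \<in> N. f u = c}))"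
proof -
  define alt where "alt = (\<lambda>X. SOME d. d \<in> X \<and> d \<noteq> c)"
  have alt: "alt X \<in> X \<and> alt X \<noteq> c" if "\<not> card X \<le> 1" for X
  proof -
    have "\<not> X \<subseteq> {c}"
    proof
      assume "X \<subseteq> {c}"
      then have "card X \<le> card {c}" by (intro card_mono) auto
      then show False using that by simp
    qed
    then have "\<exists>d. d \<in> X \<and> d \<noteq> c" by blast
    then show ?thesis unfolding alt_def by (rule someI_ex)
  qed
  define T where "T = {f \<in> colourings H. c \<notin> f ` N}"
  define cls where "cls = (\<lambda>f. {u \<in> N. f u = c})"
  define reset where "reset = (\<lambda>f u. if u \<in> cls f then alt (avail H f u) else f u)"
  define put where "put = (\<lambda>f A (u::'a). if u \<in> A then c else f u)"
  \<comment> \<open>\<open>S g\<close> collects the vertices that \<open>reset\<close> could have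
    changed on the way to \<open>g\<close>; exactly its independent subsets can be turned back to
    \<open>c\<close>.\<close>
  define S where "S = (\<lambda>f. {u \<in> N. c \<in> avail H f u \<and> alt (avail H f u) = f u})"
  have finN: "finite N" using H NH finite_subset by blast
  \<comment> \<open>No neighbour of a vertex coloured \<open>c\<close> is itself coloured
    \<open>c\<close>, so \<open>reset\<close> does not touch the colours around such a
    vertex.\<close>
  have reset_avail: "avail H (reset f) u = avail H f u" if "f \<in> good" "u \<in> cls f" for f u
  proof (rule avail_cong)
    fix w assume "w \<in> H" "E u w"
    moreover have "f \<in> colourings H" "u \<in> H" using that NH unfolding good cls_def by auto
    ultimately have "f u \<noteq> f w" unfolding colourings_def by blast
    then have "w \<notin> cls f" using that(2) unfolding cls_def by simp
    then show "reset f w = f w" unfolding reset_def by simp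
  qed
  have reset_T: "reset f \<in> T" if f: "f \<in> good" for f
  proof -
    have fc: "f \<in> colourings H" using f good by simp
    have a: "alt (avail H f u) \<in> avail H f u" "alt (avail H f u) \<noteq> c" if "u \<in> cls f" for u
      using alt[of "avail H f u"] f that unfolding good cls_def by auto
    have "reset f \<in> Pi\<^sub>E H L"
      using fc a NH unfolding reset_def colourings_def cls_def avail_def PiE_def extensional_def by auto
    moreover have "reset f x \<noteq> reset f y" if "x \<in> H" "y \<in> H" "E x y" for x y
    proof -
      have n: "f x \<noteq> f y" using fc that unfolding colourings_def by blast
      then have "\<not> (x \<in> cls f \<and> y \<in> cls f)" unfolding cls_def by auto
      moreover have "x \<in> cls f \<Longrightarrow> alt (avail H f x) \<noteq> f y" "y \<in> cls f \<Longrightarrow> alt (avail H f y) \<noteq> f x"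
        using a(1)[of x] a(1)[of y] that sym[OF that(3)] unfolding avail_def by auto
      ultimately show ?thesis using n unfolding reset_def by auto
    qed
    ultimately have "reset f \<in> colourings H" unfolding colourings_def by blast
    moreover have "c \<notin> reset f ` N" using a(2) unfolding reset_def cls_def by auto
    ultimately show ?thesis unfolding T_def by blast
  qed
  \<comment> \<open>A good colouring is encoded by its representative in \<open>T\<close> and its
    set of vertices of \<open>N\<close> coloured \<open>c\<close>; the empty set encodes the
    representative itself.\<close>
  have bij: "bij_betw (\<lambda>f. (reset f, cls f)) good (Sigma T (\<lambda>g. indep_sets E (S g)))"
  proof (rule bij_betw_byWitness[where f' = "\<lambda>(g, A). put g A"])
    show "\<forall>f\<in>good. (case (reset f, cls f) of (g, A) \<Rightarrow> put g A) = f"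
      by (auto simp: put_def reset_def cls_def)
    show "(\<lambda>f. (reset f, cls f)) ` good \<subseteq> Sigma T (\<lambda>g. indep_sets E (S g))"
    proof clarify
      fix f assume f: "f \<in> good"
      then have fc: "f \<in> colourings H" using good by simp
      have "cls f \<subseteq> S (reset f)"
      proof
        fix u assume u: "u \<in> cls f"
        then have "u \<in> N" "f u = c" "u \<in> H" using NH unfolding cls_def by auto
        moreover have "c \<in> avail H f u" using avail_self[OF fc] calculation by metis
        moreover have "reset f u = alt (avail H f u)" using u unfolding reset_def by simp
        ultimately show "u \<in> S (reset f)" using reset_avail[OF f u] unfolding S_def by simp
      qed
      moreover have "\<forall>x\<in>cls f. \<forall>y\<in>cls f. \<not> E x y"
      proof (intro ballI notI)
        fix x y assume xy: "x \<in> cls f" "y \<in> cls f" "E x y"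
        then have "f x = f y" "x \<in> H" "y \<in> H" using NH unfolding cls_def by auto
        then show False using fc xy(3) unfolding colourings_def by blast
      qed
      ultimately show "reset f \<in> T \<and> cls f \<in> indep_sets E (S (reset f))"
        using reset_T[OF f] unfolding indep_sets_def by blast
    qed
    have put: "put g A \<in> good \<and> cls (put g A) = A \<and> reset (put g A) = g"
      if g: "g \<in> T" and A: "A \<in> indep_sets E (S g)" for g A
    proof -
      have gc: "g \<in> colourings H" "c \<notin> g ` N" using g unfolding T_def by auto
      have AS: "u \<in> N" "u \<in> H" "c \<in> avail H g u" "alt (avail H g u) = g u" if "u \<in> A" for u
        using A that NH unfolding indep_sets_def S_def by auto
      have cls: "cls (put g A) = A" using gc(2) AS(1) unfolding cls_def put_def by auto
      have "put g A \<in> Pi\<^sub>E H L"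
        using gc(1) AS unfolding put_def colourings_def avail_def PiE_def extensional_def by auto
      moreover have "put g A x \<noteq> put g A y" if xy: "x \<in> H" "y \<in> H" "E x y" for x y
      proof -
        have "\<not> (x \<in> A \<and> y \<in> A)" "g x \<noteq> g y"
          using A gc(1) xy unfolding indep_sets_def colourings_def by auto
        moreover have "x \<in> A \<Longrightarrow> g y \<noteq> c" "y \<in> A \<Longrightarrow> g x \<noteq> c"
          using AS(3)[of x] AS(3)[of y] xy sym[OF xy(3)] unfolding avail_def by auto
        ultimately show ?thesis unfolding put_def by auto
      qed
      ultimately have pc: "put g A \<in> colourings H" unfolding colourings_def by blast
      have av: "avail H (put g A) u = avail H g u" if "u \<in> A" for u
        by (rule avail_cong) (use A that in \<open>auto simp: put_def indep_sets_def\<close>)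
      \<comment> \<open>The old colour \<open>g u\<close> and \<open>c\<close> are two distinct
        available colours, so turning \<open>u\<close> to \<open>c\<close> stays inside
        \<open>good\<close>.\<close>
      have free: "\<not> card (avail H g u) \<le> 1" if u: "u \<in> A" for u
      proof -
        have "g u \<in> avail H g u" "g u \<noteq> c" using avail_self[OF gc(1)] AS[OF u] gc(2) by auto
        then show ?thesis using AS(3)[OF u] finite_avail[of H g u]
          by (metis One_nat_def card_le_Suc0_iff_eq)
      qed
      have "\<not> card (avail H (put g A) u) \<le> 1" if "u \<in> N" "put g A u = c" for u
      proof -
        have "u \<in> A" using cls that unfolding cls_def by blast
        then show ?thesis using free av by simp
      qed
      then have "put g A \<in> good" using pc unfolding good by blast
      moreover have "reset (put g A) = g"
        using cls av AS(4) by (auto simp: reset_def put_def)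
      ultimately show ?thesis using cls by blast
    qed
    show "\<forall>p\<in>Sigma T (\<lambda>g. indep_sets E (S g)).
        (reset (case p of (g, A) \<Rightarrow> put g A), cls (case p of (g, A) \<Rightarrow> put g A)) = p"
      using put by auto
    show "(\<lambda>(g, A). put g A) ` Sigma T (\<lambda>g. indep_sets E (S g)) \<subseteq> good"
      using put by auto
  qed
  have finT: "finite T" unfolding T_def using finite_colourings[OF H] by simp
  have SN: "S g \<subseteq> N" for g unfolding S_def by blast
  have finI: "finite (indep_sets E (S g))" for g
    using finite_indep_sets finite_subset[OF SN finN] by blast
  have "(\<Sum>f\<in>good. real (card (cls f))) = (\<Sum>p\<in>Sigma T (\<lambda>g. indep_sets E (S g)). real (card (snd p)))"
    using sum.reindex_bij_betw[OF bij, of "\<lambda>p. real (card (snd p))"] by simp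
  also have "\<dots> = (\<Sum>g\<in>T. \<Sum>A\<in>indep_sets E (S g). real (card A))"
    using finT finI by (simp add: sum.Sigma case_prod_beta)
  finally have sumcls: "(\<Sum>f\<in>good. real (card (cls f))) = (\<Sum>g\<in>T. \<Sum>A\<in>indep_sets E (S g). real (card A))" .
  have "card good = card (Sigma T (\<lambda>g. indep_sets E (S g)))" using bij by (rule bij_betw_same_card)
  then have "real (card good) = (\<Sum>g\<in>T. real (card (indep_sets E (S g))))"
    using finT finI by simp
  \<comment> \<open>The hypothesis on independent sets is applied to each class; \<open>T\<close>
    has one element per class, and the sizes add up to those of the colour classes of
    \<open>c\<close>.\<close>
  also have "\<dots> \<le> (\<Sum>g\<in>T. M + K * (\<Sum>A\<in>indep_sets E (S g). real (card A)))"
    by (intro sum_mono indep SN)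
  also have "\<dots> = M * card T + K * (\<Sum>f\<in>good. real (card (cls f)))"
    by (simp add: sumcls sum.distrib sum_distrib_left)
  finally show ?thesis unfolding T_def cls_def .
qed

lemma card_colourings_insert_ge:
  fixes M K l :: real
  assumes H: "finite H" and v: "v \<notin> H"
    and deg: "card {u \<in> H. E v u} \<le> d" and q: "card (L v) = q"
    and indep: "\<And>S. S \<subseteq> H \<Longrightarrow> card (indep_sets E S) \<le> M + K * (\<Sum>A\<in>indep_sets E S. real (card A))"
    and pos: "M > 0" "K \<ge> 0" "l > 0"
    and large: "q - K * d - d / l \<ge> M * l"
    and IH: "\<And>u. u \<in> H \<Longrightarrow> l * card (colourings (H - {u})) \<le> card (colourings H)"
  shows "l * card (colourings H) \<le> card (colourings (insert v H))"
proof -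
  define N where "N = {u \<in> H. E v u}"
  define good where "good = (\<lambda>c. {f \<in> colourings H. \<forall>u\<in>N. f u = c \<longrightarrow> \<not> card (avail H f u) \<le> 1})"
  let ?C = "colourings H"
  let ?P = "real (card ?C)"
  have NH: "N \<subseteq> H" and finN: "finite N" using H unfolding N_def by auto
  have finC: "finite ?C" by (rule finite_colourings[OF H])
  have each: "?P \<le> M * card {f \<in> ?C. c \<notin> f ` N}
      + K * (\<Sum>f\<in>?C. real (card {u \<in> N. f u = c}))
      + (\<Sum>u\<in>N. real (card {f \<in> ?C. f u = c \<and> card (avail H f u) \<le> 1}))" for c
  proof -
    \<comment> \<open>Either every neighbour coloured \<open>c\<close> can be switched, or one of
      them is frozen; the union bound handles the latter.\<close>
    have "?C \<subseteq> good c \<union> (\<Union>u\<in>N. {f \<in> ?C. f u = c \<and> card (avail H f u) \<le> 1})"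
      unfolding good_def by auto
    then have "card ?C \<le> card (good c \<union> (\<Union>u\<in>N. {f \<in> ?C. f u = c \<and> card (avail H f u) \<le> 1}))"
      using finC finN by (intro card_mono) (auto simp: good_def)
    also have "\<dots> \<le> card (good c) + card (\<Union>u\<in>N. {f \<in> ?C. f u = c \<and> card (avail H f u) \<le> 1})"
      by (rule card_Un_le)
    also have "\<dots> \<le> card (good c) + (\<Sum>u\<in>N. card {f \<in> ?C. f u = c \<and> card (avail H f u) \<le> 1})"
      using card_UN_le[OF finN] by (rule add_left_mono)
    finally have "?P \<le> real (card (good c) + (\<Sum>u\<in>N. card {f \<in> ?C. f u = c \<and> card (avail H f u) \<le> 1}))"
      by (rule of_nat_mono)
    moreover have "card (good c) \<le> M * card {f \<in> ?C. c \<notin> f ` N}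
        + K * (\<Sum>f\<in>good c. real (card {u \<in> N. f u = c}))"
    proof (rule card_switch_colour_le[OF H NH])
      show "card (indep_sets E S) \<le> M + K * (\<Sum>A\<in>indep_sets E S. real (card A))" if "S \<subseteq> N" for S
        using that NH by (intro indep) blast
    qed (simp add: good_def)
    moreover have "(\<Sum>f\<in>good c. real (card {u \<in> N. f u = c})) \<le> (\<Sum>f\<in>?C. real (card {u \<in> N. f u = c}))"
      using finC by (intro sum_mono2) (auto simp: good_def)
    then have "K * (\<Sum>f\<in>good c. real (card {u \<in> N. f u = c})) \<le> K * (\<Sum>f\<in>?C. real (card {u \<in> N. f u = c}))"
      using pos(2) by (rule mult_left_mono)
    ultimately show ?thesis by simp
  qed
  have 1: "(\<Sum>c\<in>L v. real (card {f \<in> ?C. c \<notin> f ` N})) = card (colourings (insert v H))"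
  proof -
    have "(\<Sum>c\<in>L v. card {f \<in> ?C. c \<notin> f ` N}) = (\<Sum>f\<in>?C. card {c \<in> L v. c \<notin> f ` N})"
      by (rule sum_card_swap[OF finite_list finC])
    also have "\<dots> = (\<Sum>f\<in>?C. card (avail H f v))"
      by (intro sum.cong arg_cong[where f = card]) (auto simp: avail_def N_def)
    also have "\<dots> = card (colourings (insert v H))" by (rule card_colourings_insert[OF H v, symmetric])
    finally show ?thesis by (simp only: of_nat_sum[symmetric])
  qed
  \<comment> \<open>Every neighbour has only one colour, so over all \<open>c\<close> it is counted
    at most once.\<close>
  have 2: "(\<Sum>c\<in>L v. \<Sum>f\<in>?C. real (card {u \<in> N. f u = c})) \<le> d * ?P"
  proof -
    have "(\<Sum>c\<in>L v. real (card {u \<in> N. f u = c})) \<le> d" for f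
    proof -
      have "(\<Sum>c\<in>L v. card {u \<in> N. f u = c}) = (\<Sum>u\<in>N. card {c \<in> L v. f u = c})"
        by (rule sum_card_swap[OF finite_list finN])
      also have "\<dots> \<le> (\<Sum>u\<in>N. 1)"
        by (intro sum_mono) (auto simp: card_le_Suc0_iff_eq finite_list)
      also have "\<dots> \<le> d" using deg N_def by simp
      finally show ?thesis by (simp only: of_nat_sum[symmetric] of_nat_le_iff)
    qed
    then have "(\<Sum>f\<in>?C. \<Sum>c\<in>L v. real (card {u \<in> N. f u = c})) \<le> (\<Sum>f\<in>?C. real d)"
      by (rule sum_mono)
    then show ?thesis by (subst sum.swap) (simp add: mult.commute)
  qed
  \<comment> \<open>A frozen neighbour \<open>u\<close> is again counted for one \<open>c\<close>
    only; erasing its colour and the induction hypothesis bound the colourings in which it is frozen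
    by \<open>?P / l\<close>.\<close>
  have 3: "(\<Sum>c\<in>L v. \<Sum>u\<in>N. real (card {f \<in> ?C. f u = c \<and> card (avail H f u) \<le> 1})) \<le> d / l * ?P"
  proof -
    have "(\<Sum>c\<in>L v. real (card {f \<in> ?C. f u = c \<and> card (avail H f u) \<le> 1})) \<le> ?P / l" if u: "u \<in> N" for u
    proof -
      let ?B = "{f \<in> ?C. card (avail H f u) \<le> 1}"
      have "(\<Sum>c\<in>L v. card {f \<in> ?C. f u = c \<and> card (avail H f u) \<le> 1}) = (\<Sum>c\<in>L v. card {f \<in> ?B. f u = c})"
        by (intro sum.cong arg_cong[where f = card]) auto
      also have "\<dots> = (\<Sum>f\<in>?B. card {c \<in> L v. f u = c})"
        using finC by (intro sum_card_swap finite_list) simp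
      also have "\<dots> \<le> (\<Sum>f\<in>?B. 1)"
        by (intro sum_mono) (auto simp: card_le_Suc0_iff_eq finite_list)
      also have "\<dots> \<le> card (colourings (H - {u}))"
        using card_frozen_le[OF H, of u] u NH by auto
      finally have "(\<Sum>c\<in>L v. real (card {f \<in> ?C. f u = c \<and> card (avail H f u) \<le> 1}))
          \<le> card (colourings (H - {u}))" by (simp only: of_nat_sum[symmetric] of_nat_le_iff)
      also have "\<dots> \<le> ?P / l" using IH[of u] u NH pos(3) by (auto simp: field_simps)
      finally show ?thesis .
    qed
    then have "(\<Sum>u\<in>N. \<Sum>c\<in>L v. real (card {f \<in> ?C. f u = c \<and> card (avail H f u) \<le> 1})) \<le> (\<Sum>u\<in>N. ?P / l)"
      by (rule sum_mono)
    also have "\<dots> = card N * (?P / l)" by simp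
    also have "\<dots> \<le> d * (?P / l)" using deg pos(3) unfolding N_def by (intro mult_right_mono) auto
    finally show ?thesis by (subst sum.swap) (simp add: mult.commute)
  qed
  have "q * ?P = (\<Sum>c\<in>L v. ?P)" using q by simp
  also have "\<dots> \<le> (\<Sum>c\<in>L v. M * card {f \<in> ?C. c \<notin> f ` N}
      + K * (\<Sum>f\<in>?C. real (card {u \<in> N. f u = c}))
      + (\<Sum>u\<in>N. real (card {f \<in> ?C. f u = c \<and> card (avail H f u) \<le> 1})))"
    by (rule sum_mono) (rule each)
  also have "\<dots> = M * card (colourings (insert v H))
      + K * (\<Sum>c\<in>L v. \<Sum>f\<in>?C. real (card {u \<in> N. f u = c}))
      + (\<Sum>c\<in>L v. \<Sum>u\<in>N. real (card {f \<in> ?C. f u = c \<and> card (avail H f u) \<le> 1}))"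
    by (simp only: sum.distrib sum_distrib_left[symmetric] 1)
  also have "\<dots> \<le> M * card (colourings (insert v H)) + K * (d * ?P) + d / l * ?P"
    using 3 mult_left_mono[OF 2 pos(2)] by linarith
  finally have "(q - K * d - d / l) * ?P \<le> M * card (colourings (insert v H))"
    by (simp add: algebra_simps)
  moreover have "M * l * ?P \<le> (q - K * d - d / l) * ?P" using large by (intro mult_right_mono) auto
  ultimately have "M * (l * ?P) \<le> M * card (colourings (insert v H))" by (simp add: mult.assoc)
  then show ?thesis using pos(1) by simp
qed

text \<open>From the single colouring of the empty set on, each added vertex multiplies the count by
  at least \<open>l > 0\<close>, so it never vanishes.\<close>

lemma colouring_exists:
  fixes M K l :: real
  assumes V: "finite V"
    and deg: "\<And>v. v \<in> V \<Longrightarrow> card {u \<in> V. E v u} \<le> d" and q: "\<And>v. v \<in> V \<Longrightarrow> card (L v) = q"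
    and indep: "\<And>S. S \<subseteq> V \<Longrightarrow> card (indep_sets E S) \<le> M + K * (\<Sum>A\<in>indep_sets E S. real (card A))"
    and pos: "M > 0" "K \<ge> 0" "l > 0"
    and large: "q - K * d - d / l \<ge> M * l"
  shows "\<exists>f. f \<in> colourings V"
proof -
  \<comment> \<open>The induction is over all pairs by the size of \<open>H\<close>: the step for
    \<open>H\<close> and \<open>v\<close> uses the claim for \<open>H - {u}\<close> and the
    different vertex \<open>u\<close>.\<close>
  have step: "l * card (colourings H) \<le> card (colourings (insert v H))"
    if "H \<subseteq> V" "v \<in> V" "v \<notin> H" for H v
    using that
  proof (induction "card H" arbitrary: H v rule: less_induct)
    case less
    have H: "finite H" using less.prems V finite_subset by blast
    show ?case
    proof (rule card_colourings_insert_ge[OF H less.prems(3) _ q[OF less.prems(2)] _ pos large])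
      have "card {u \<in> H. E v u} \<le> card {u \<in> V. E v u}"
        using less.prems V by (intro card_mono) auto
      then show "card {u \<in> H. E v u} \<le> d" using deg[OF less.prems(2)] by linarith
      show "card (indep_sets E S) \<le> M + K * (\<Sum>A\<in>indep_sets E S. real (card A))" if "S \<subseteq> H" for S
        using that less.prems(1) by (intro indep) blast
      show "l * card (colourings (H - {u})) \<le> card (colourings H)" if u: "u \<in> H" for u
      proof -
        have "card (H - {u}) < card H" using H u by (rule card_Diff1_less)
        from less.hyps[OF this, of u] show ?thesis using u less.prems by (auto simp: insert_absorb)
      qed
    qed
  qed
  have "card (colourings H) > 0" if "H \<subseteq> V" for H
    using finite_subset[OF that V] that
  proof (induction H rule: finite_induct)
    case empty
    then show ?case by (simp add: colourings_def)
  next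
    case (insert v H)
    then have "0 < l * card (colourings H)" using pos by simp
    also have "\<dots> \<le> card (colourings (insert v H))" using step[of H v] insert by simp
    finally show ?case by simp
  qed
  from this[of V] show ?thesis by (metis all_not_in_conv card.empty less_irrefl subset_refl)
qed

text \<open>The neighbours of \<open>v\<close> block fewer colours than its list holds. This serves
  when the asserted bound is at least \<open>\<Delta> + 1\<close>.\<close>

lemma greedy_colouring_exists:
  assumes V: "finite V"
    and deg: "\<And>v. v \<in> V \<Longrightarrow> card {u \<in> V. E v u} < card (L v)"
  shows "\<exists>f. f \<in> colourings V"
proof -
  have "colourings H \<noteq> {}" if "H \<subseteq> V" for H
    using finite_subset[OF that V] that
  proof (induction H rule: finite_induct)
    case empty
    then show ?case by (simp add: colourings_def)
  next
    case (insert v H)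
    then obtain f where f: "f \<in> colourings H" by blast
    have v: "v \<in> V" and H: "H \<subseteq> V" using insert.prems by auto
    have "card (f ` {u \<in> H. E v u}) \<le> card {u \<in> H. E v u}"
      using insert.hyps(1) by (intro card_image_le) auto
    also have "\<dots> \<le> card {u \<in> V. E v u}" using V H by (intro card_mono) auto
    also have "\<dots> < card (L v)" by (rule deg[OF v])
    finally have "\<not> L v \<subseteq> f ` {u \<in> H. E v u}"
      using insert.hyps(1) card_mono[of "f ` {u \<in> H. E v u}" "L v"] by auto
    then have "avail H f v \<noteq> {}" unfolding avail_def by auto
    then have "card (avail H f v) > 0" using finite_avail card_gt_0_iff by blast
    then have "0 < (\<Sum>f\<in>colourings H. card (avail H f v))"
      using f finite_colourings[OF insert.hyps(1)] by (intro sum_pos2[of _ f]) auto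
    then show ?case using card_colourings_insert[OF insert.hyps(1,2)] by force
  qed
  then show ?thesis by blast
qed

end

section \<open>Numerical estimates in terms of \<open>D = ln \<Delta>\<close>\<close>

text \<open>
  The theorem says more than the greedy bound only if \<open>D = ln \<Delta>\<close> exceeds \<open>600 * ln D\<close>.
\<close>

lemma large_of_less_ln:
  fixes D :: real
  assumes "D \<ge> 101/100" and "600 * ln D < D"
  shows "D \<ge> 598"
proof (rule ccontr)
  assume "\<not> D \<ge> 598"
  \<comment> \<open>The bound \<open>ln D \<ge> 1 - 1 / D\<close> turns the hypothesis into
    \<open>D * D - 600 * D + 600 > 0\<close>. The roots of this quadratic lie just above 1 and just
    below 599, so no \<open>D\<close> from 101/100 to 598 satisfies it.\<close>
  have "ln (1 / D) \<le> 1 / D - 1" using assms by (intro ln_le_minus_one) simp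
  then have "1 - 1 / D \<le> ln D" using assms by (simp add: ln_div)
  then have "600 * (1 - 1 / D) \<le> 600 * ln D" by simp
  then have "600 * (1 - 1 / D) < D" using assms(2) by (rule le_less_trans)
  then have "600 * D - 600 < D * D" using assms by (simp add: field_simps)
  moreover have "(D - 101/100) * (598 - D) \<ge> 0"
    using assms \<open>\<not> D \<ge> 598\<close> by (intro mult_nonneg_nonneg) auto
  moreover have "(D - 101/100) * (598 - D) = 59901/100 * D - D * D - 60398/100"
    by (simp add: field_simps)
  ultimately show False using assms(1) by linarith
qed

text \<open>Exceeding 1 by this margin matters twice: it makes \<open>ln (ln \<Delta>)\<close>
  positive and clears the smaller root of the quadratic above.\<close>

lemma ln_3_ge: "ln (3::real) \<ge> 101/100"
proof -
  have "exp (101/100::real) = exp 1 * exp (1/100)" by (simp flip: exp_add)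
  also have "\<dots> \<le> 2.72 * (1 + 1/100 + (1/100)\<^sup>2)"
    using e_less_272 by (intro mult_mono exp_bound) auto
  also have "\<dots> \<le> 3" by (simp add: power2_eq_square)
  finally show ?thesis by (subst ln_ge_iff) auto
qed

text \<open>Supplies the threshold \<open>M = exp (D / 3)\<close>, the cube root of
  \<open>\<Delta>\<close>, for \<open>card_indep_sets_le\<close> with \<open>m = s * k\<close>.
  After taking logarithms, the tangent of \<open>ln\<close> at \<open>D\<close> reduces the claim to
  an inequality linear in \<open>ln z\<close>.\<close>

lemma power_log_le:
  fixes D x z :: real
  assumes D: "D \<ge> 598" and m: "m * ln D \<le> D / 4" and z: "z \<ge> exp (D / 3)"
  shows "2 * (1 + log 2 z) ^ m \<le> z"
proof -
  define x where "x = ln z"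
  have zpos: "z > 0" using z exp_gt_zero less_le_trans by blast
  have x: "x \<ge> D / 3" using z zpos unfolding x_def by (subst ln_ge_iff)
  \<comment> \<open>The factor 3/2 comes from \<open>ln 2 \<ge> 2 / 3\<close>.\<close>
  define y where "y = 1 + 3 / 2 * x"
  have y: "y > 0" using x D unfolding y_def by simp
  have ln2: "2 / 3 \<le> ln (2::real)" "ln (2::real) \<le> 1"
    using ln2_ge_two_thirds ln_2_less_1 by auto
  have "x / ln 2 \<le> x / (2 / 3)" using x D ln2 by (intro divide_left_mono) auto
  then have logy: "1 + log 2 z \<le> y" unfolding log_def x_def[symmetric] y_def by simp
  have lognn: "0 \<le> 1 + log 2 z" unfolding log_def x_def[symmetric] using x D by simp
  have "ln (y / D) \<le> y / D - 1" using y D by (intro ln_le_minus_one) simp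
  then have lny: "ln y \<le> ln D + (y - D) / D" using y D by (simp add: ln_div diff_divide_distrib)
  have "exp 1 \<le> D" using e_less_272 D by linarith
  then have "1 \<le> ln D" using D by (simp add: ln_ge_iff)
  then have "real m * 1 \<le> real m * ln D" by (intro mult_left_mono) auto
  then have mD: "m / D \<le> 1 / 4" using m D by (simp add: field_simps)
  have "m * ln y \<le> m * (ln D + (y - D) / D)" using lny by (intro mult_left_mono) auto
  also have "\<dots> = m * ln D + m / D * (y - D)" by (simp add: algebra_simps)
  \<comment> \<open>The bound \<open>m / D \<le> 1 / 4\<close> helps only if
    \<open>y \<ge> D\<close>; below \<open>D\<close> the tangent term is at most 0, hence the
    maximum.\<close>
  also have "\<dots> \<le> D / 4 + max 0 ((y - D) / 4)"
  proof (cases "y \<ge> D")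
    case True
    then have "m / D * (y - D) \<le> 1 / 4 * (y - D)" using mD by (intro mult_right_mono) auto
    also have "\<dots> \<le> max 0 ((y - D) / 4)" by simp
    finally show ?thesis using m by linarith
  next
    case False
    then have "m / D * (y - D) \<le> 0" using D by (intro mult_nonneg_nonpos) auto
    also have "\<dots> \<le> max 0 ((y - D) / 4)" by simp
    finally show ?thesis using m by linarith
  qed
  \<comment> \<open>If \<open>y \<ge> D\<close>, the left side is
    \<open>y / 4 = 1 / 4 + 3 / 8 * x\<close>; otherwise it is \<open>D / 4 \<le> 3 / 4 * x\<close>.
    Both leave room for \<open>ln 2\<close>, as \<open>x\<close> is large.\<close>
  also have "\<dots> \<le> x - ln 2" using x D ln2 unfolding y_def by (auto simp: max_def field_simps)
  finally have "ln 2 + m * ln y \<le> x" by simp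
  then have "exp (ln 2 + m * ln y) \<le> exp x" by simp
  moreover have "exp (ln 2 + m * ln y) = 2 * y ^ m"
    using y by (simp add: exp_add exp_of_nat_mult)
  moreover have "exp x = z" unfolding x_def using zpos by simp
  moreover have "(1 + log 2 z) ^ m \<le> y ^ m" using logy lognn by (rule power_mono)
  ultimately show ?thesis by linarith
qed

text \<open>This is the hypothesis \<open>large\<close> of \<open>colouring_exists\<close> for
  \<open>M = l = exp (D / 3)\<close>. In multiples of \<open>t * exp D / D\<close>, the list has 200
  before rounding, \<open>K * d\<close> costs at most 8, and each of the remaining terms, rounding
  included, at most 3. The size of 200 is felt only in the reduction to
  \<open>D \<ge> 598\<close>.\<close>

lemma list_size_large_enough:
  fixes D r b :: real
  assumes D: "D \<ge> 598" and r: "r \<ge> 4"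
    and b: "b = 200 * r * (exp D * ln D / D)" and k: "k = nat \<lfloor>D / (4 * r * ln D)\<rfloor>"
  shows "real (nat \<lfloor>b\<rfloor>) - 2 / (real k + 1) * exp D - exp D / exp (D / 3) \<ge> exp (D / 3) * exp (D / 3)"
proof -
  have "exp 1 \<le> D" using e_less_272 D by linarith
  then have lnD: "1 \<le> ln D" using D by (simp add: ln_ge_iff)
  define t where "t = r * ln D"
  have t: "t \<ge> 4" using mult_mono[OF r lnD] r unfolding t_def by simp
  have bt: "b = 200 * (t * exp D / D)" unfolding b t_def by simp
  have "b \<ge> 0" using bt t D by simp
  then have q: "real (nat \<lfloor>b\<rfloor>) \<ge> b - 1" by linarith
  have "real k + 1 \<ge> D / (4 * t)" unfolding k t_def by (simp add: mult.assoc) linarith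
  then have "2 / (real k + 1) \<le> 2 / (D / (4 * t))" using D t by (intro divide_left_mono) auto
  also have "\<dots> = 8 * t / D" by simp
  finally have "2 / (real k + 1) * exp D \<le> 8 * t / D * exp D" by (intro mult_right_mono) auto
  then have K: "2 / (real k + 1) * exp D \<le> 8 * (t * exp D / D)" by simp
  have e: "exp D = exp (2 * D / 3) * exp (D / 3)" by (simp flip: exp_add)
  have e1: "exp D / exp (D / 3) = exp (2 * D / 3)" unfolding e by simp
  have e2: "exp (D / 3) * exp (D / 3) = exp (2 * D / 3)" by (simp flip: exp_add)
  have "D / 3 \<le> exp (D / 3)" using exp_ge_add_one_self[of "D / 3"] by linarith
  then have "exp (2 * D / 3) * (D / 3) \<le> exp D" unfolding e by (intro mult_left_mono) auto
  then have "exp (2 * D / 3) / 3 \<le> exp D / D" using D by (simp add: field_simps)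
  also have "\<dots> \<le> t * (exp D / D)" using t D mult_right_mono[of 1 t "exp D / D"] by simp
  finally have "exp (2 * D / 3) \<le> 3 * (t * exp D / D)" by (simp add: field_simps)
  moreover have "1 \<le> exp (2 * D / 3)" using D by simp
  ultimately show ?thesis using q K bt unfolding e1 e2 by linarith
qed

section \<open>Degrees, cliques and choosability in symmetric digraphs\<close>

context graph
begin

lemma card_neighbours_le_max_degree:
  assumes "v \<in> verts G"
  shows "card {u \<in> verts G. v \<rightarrow>\<^bsub>G\<^esub> u} \<le> max_degree G"
proof -
  have "{u \<in> verts G. v \<rightarrow>\<^bsub>G\<^esub> u} \<subseteq> head G ` out_arcs G v"
    by (auto simp: arcs_ends_def arc_to_ends_def)
  then have "card {u \<in> verts G. v \<rightarrow>\<^bsub>G\<^esub> u} \<le> card (head G ` out_arcs G v)"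
    by (intro card_mono) auto
  also have "\<dots> \<le> out_degree G v" unfolding out_degree_def by (intro card_image_le) auto
  also have "\<dots> \<le> max_degree G" unfolding max_degree_def using assms by (intro Max_ge) auto
  finally show ?thesis .
qed

text \<open>Lets the exclusion of a complete subgraph be used for sets of mutually adjacent
  vertices, as the Ramsey bound requires.\<close>

lemma clique_imp_complete_subgraph:
  assumes C: "C \<subseteq> verts G" "card C = r"
    and adj: "\<And>x y. x \<in> C \<Longrightarrow> y \<in> C \<Longrightarrow> x \<noteq> y \<Longrightarrow> x \<rightarrow>\<^bsub>G\<^esub> y"
  shows "\<exists>H. subgraph H G \<and> K\<^bsub>r\<^esub> H"
proof (intro exI conjI)
  show "subgraph (G \<restriction> C) G" using induced_induce[OF C(1)] by (rule induced_imp_subgraph)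
  have "graph (G \<restriction> C)"
    using digraphI_induced[OF induced_induce[OF C(1)]]
      induced_graph_imp_symmetric[OF sym_arcs induced_induce[OF C(1)]]
    by (rule digraph.graphI)
  moreover have "arcs_ends (G \<restriction> C) = {(u, v). (u, v) \<in> C \<times> C \<and> u \<noteq> v}"
  proof (intro equalityI subsetI)
    fix p assume "p \<in> arcs_ends (G \<restriction> C)"
    then show "p \<in> {(u, v). (u, v) \<in> C \<times> C \<and> u \<noteq> v}"
      using no_loops by (auto simp: arcs_ends_def arc_to_ends_def)
  next
    fix p assume "p \<in> {(u, v). (u, v) \<in> C \<times> C \<and> u \<noteq> v}"
    then obtain u v where p: "p = (u, v)" "u \<in> C" "v \<in> C" "u \<noteq> v" by auto
    then obtain e where "e \<in> arcs G" "tail G e = u" "head G e = v"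
      using adj[of u v] by (auto simp: arcs_ends_def arc_to_ends_def)
    then show "p \<in> arcs_ends (G \<restriction> C)"
      using p by (force simp: arcs_ends_def arc_to_ends_def)
  qed
  ultimately show "K\<^bsub>r\<^esub> (G \<restriction> C)" using C(2) unfolding complete_digraph_def by simp
qed

lemma choosableI:
  assumes "\<And>L :: 'a \<Rightarrow> nat set. list_assignment (\<lambda>u v. u \<rightarrow>\<^bsub>G\<^esub> v) L \<Longrightarrow>
      (\<And>v. v \<in> verts G \<Longrightarrow> card (L v) = q) \<Longrightarrow>
      \<exists>f. f \<in> list_assignment.colourings (\<lambda>u v. u \<rightarrow>\<^bsub>G\<^esub> v) L (verts G)"
  shows "choosable q G"
  unfolding choosable_def
proof (intro allI impI)
  fix L :: "'a \<Rightarrow> nat set"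
  assume L: "\<forall>v\<in>verts G. finite (L v) \<and> card (L v) = q"
  \<comment> \<open>The locale wants finite lists on the whole type, whereas lists outside the graph
    are arbitrary; these are emptied.\<close>
  define L' where "L' = (\<lambda>v. if v \<in> verts G then L v else {})"
  interpret list_assignment "\<lambda>u v. u \<rightarrow>\<^bsub>G\<^esub> v" L'
  proof
    show "y \<rightarrow>\<^bsub>G\<^esub> x" if "x \<rightarrow>\<^bsub>G\<^esub> y" for x y using that by (rule graph_symmetric)
    show "\<not> x \<rightarrow>\<^bsub>G\<^esub> x" for x using adj_not_same by blast
    show "finite (L' v)" for v using L unfolding L'_def by simp
  qed
  obtain f where f: "f \<in> colourings (verts G)"
    using assms[OF list_assignment_axioms] L unfolding L'_def by auto
  have "proper_colouring G f"
    unfolding proper_colouring_def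
  proof (intro allI impI)
    fix u v assume uv: "u \<rightarrow>\<^bsub>G\<^esub> v"
    then show "f u \<noteq> f v" using f adj_in_verts[OF uv] unfolding colourings_def by blast
  qed
  moreover have "f v \<in> L v" if "v \<in> verts G" for v
  proof -
    have "f v \<in> L' v" using f that unfolding colourings_def by blast
    then show ?thesis using that unfolding L'_def by simp
  qed
  ultimately show "\<exists>f. list_colouring G L f" unfolding list_colouring_def by blast
qed

lemma choosable_Suc_max_degree: "choosable (Suc (max_degree G)) G"
proof (rule choosableI)
  fix L :: "'a \<Rightarrow> nat set"
  assume "list_assignment (\<lambda>u v. u \<rightarrow>\<^bsub>G\<^esub> v) L" and q: "\<And>v. v \<in> verts G \<Longrightarrow> card (L v) = Suc (max_degree G)"
  then interpret list_assignment "\<lambda>u v. u \<rightarrow>\<^bsub>G\<^esub> v" L by blast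
  show "\<exists>f. f \<in> colourings (verts G)"
    using q card_neighbours_le_max_degree by (intro greedy_colouring_exists) (auto simp: le_imp_less_Suc)
qed

lemma choosable_of_no_clique:
  fixes r :: nat
  assumes r: "r \<ge> 4" and no_clique: "\<not> (\<exists>H. subgraph H G \<and> K\<^bsub>r\<^esub> H)"
    and D: "D = ln (max_degree G)" "D \<ge> 598"
  shows "choosable (nat \<lfloor>200 * real r * (max_degree G * ln D / D)\<rfloor>) G"
proof (rule choosableI)
  fix L :: "'a \<Rightarrow> nat set"
  let ?\<Delta> = "max_degree G"
  let ?q = "nat \<lfloor>200 * real r * (?\<Delta> * ln D / D)\<rfloor>"
  assume "list_assignment (\<lambda>u v. u \<rightarrow>\<^bsub>G\<^esub> v) L" and q: "\<And>v. v \<in> verts G \<Longrightarrow> card (L v) = ?q"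
  then interpret list_assignment "\<lambda>u v. u \<rightarrow>\<^bsub>G\<^esub> v" L by blast
  \<comment> \<open>The largest \<open>k\<close> with \<open>r * k * ln D \<le> D / 4\<close>, which
    covers the exponent \<open>(r - 1) * k\<close> in \<open>power_log_le\<close>.\<close>
  define k where "k = nat \<lfloor>D / (4 * real r * ln D)\<rfloor>"
  have lnD: "ln D > 0" using D(2) by simp
  \<comment> \<open>Since \<open>ln 0 = 0\<close>, a vanishing degree would contradict
    \<open>D \<ge> 598\<close>.\<close>
  have "?\<Delta> > 0" using D by (cases "?\<Delta>") auto
  then have \<Delta>: "real ?\<Delta> = exp D" unfolding D(1) by simp
  have "real k \<le> D / (4 * real r * ln D)"
    unfolding k_def using lnD D(2) by (simp add: of_nat_nat)
  then have "real k * (real r * ln D) \<le> D / 4" using lnD r by (simp add: field_simps)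
  moreover have "real ((r - 1) * k) * ln D \<le> real (r * k) * ln D"
    using lnD by (intro mult_right_mono of_nat_mono mult_le_mono) auto
  ultimately have m: "real ((r - 1) * k) * ln D \<le> D / 4" by (simp add: algebra_simps)
  show "\<exists>f. f \<in> colourings (verts G)"
  proof (rule colouring_exists[where q = ?q and d = ?\<Delta> and M = "exp (D / 3)" and l = "exp (D / 3)"
        and K = "2 / (real k + 1)"])
    show "card (indep_sets (\<lambda>u v. u \<rightarrow>\<^bsub>G\<^esub> v) S)
        \<le> exp (D / 3) + 2 / (real k + 1) * (\<Sum>A\<in>indep_sets (\<lambda>u v. u \<rightarrow>\<^bsub>G\<^esub> v) S. real (card A))"
      if S: "S \<subseteq> verts G" for S
    proof (rule card_indep_sets_le[where s = "r - 1", OF sym irr])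
      show "finite S" using S by (rule finite_subset) simp
      show "\<exists>x\<in>C. \<exists>y\<in>C. x \<noteq> y \<and> \<not> x \<rightarrow>\<^bsub>G\<^esub> y" if "C \<subseteq> S" "card C = Suc (r - 1)" for C
      proof (rule ccontr)
        assume "\<not> ?thesis"
        moreover have "C \<subseteq> verts G" "card C = r" using that S r by auto
        ultimately show False using clique_imp_complete_subgraph[of C r] no_clique by blast
      qed
      show "2 * (1 + log 2 z) ^ ((r - 1) * k) \<le> z" if "exp (D / 3) \<le> z" for z
        using power_log_le[OF D(2) m that] .
    qed simp_all
    show "exp (D / 3) * exp (D / 3) \<le> ?q - 2 / (real k + 1) * ?\<Delta> - ?\<Delta> / exp (D / 3)"
      using list_size_large_enough[OF D(2) _ refl refl, of "real r"] r
      unfolding \<Delta> k_def[symmetric] by (simp add: add.commute)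
  qed (use q card_neighbours_le_max_degree in auto)
qed

end

theorem theorem2:
  fixes G :: "('a, 'b) pre_digraph" and r \<Delta> :: nat
  assumes "r \<ge> 4"
    and "graph G"
    and "\<not> (\<exists>H. subgraph H G \<and> K\<^bsub>r\<^esub> H)"
    and "\<Delta> = max_degree G" and "\<Delta> \<ge> 3"
  shows "real (list_chromatic_number G)
    \<le> 200 * real r * (real \<Delta> * ln (ln (real \<Delta>)) / ln (real \<Delta>))"
proof -
  interpret graph G by fact
  define D where "D = ln (real \<Delta>)"
  define b where "b = 200 * real r * (real \<Delta> * ln D / D)"
  have "ln 3 \<le> D" unfolding D_def using assms(5) by simp
  then have D1: "D \<ge> 101/100" using ln_3_ge by linarith
  then have lnD: "ln D > 0" by simp
  have least: "list_chromatic_number G \<le> q" if "choosable q G" for q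
    unfolding list_chromatic_number_def using that by (rule Least_le)
  have "real (list_chromatic_number G) \<le> b"
  \<comment> \<open>If the bound reaches \<open>\<Delta> + 1\<close>, greedy colouring suffices;
    otherwise \<open>D\<close> is large enough for the counting argument.\<close>
  proof (cases "b \<ge> real (Suc \<Delta>)")
    case True
    then show ?thesis using least[OF choosable_Suc_max_degree] assms(4) by linarith
  next
    case False
    then have "200 * real r * ln D * \<Delta> < (\<Delta> + 1) * D" using D1 unfolding b_def by (simp add: field_simps)
    \<comment> \<open>The factor 4/3 comes from \<open>\<Delta> \<ge> 3\<close>; together with
      \<open>r \<ge> 4\<close> it produces \<open>200 * 4 / (4 / 3) = 600\<close>, the constant in
      \<open>large_of_less_ln\<close>.\<close>
    also have "\<dots> \<le> 4 / 3 * \<Delta> * D" using assms(5) D1 by (intro mult_right_mono) auto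
    finally have "200 * real r * ln D * \<Delta> < (4 / 3 * D) * \<Delta>" by (simp add: mult_ac)
    then have "200 * real r * ln D < 4 / 3 * D" using assms(5) by (simp add: mult_less_cancel_right)
    moreover have "4 * ln D \<le> real r * ln D" using assms(1) lnD by (intro mult_right_mono) auto
    ultimately have "600 * ln D < D" by linarith
    then have "D \<ge> 598" using large_of_less_ln D1 by blast
    then have "list_chromatic_number G \<le> nat \<lfloor>b\<rfloor>"
      using choosable_of_no_clique[OF assms(1,3), of D] least assms(4) unfolding b_def D_def by simp
    moreover have "b \<ge> 0" using D1 lnD unfolding b_def by simp
    ultimately show ?thesis by linarith
  qed
  then show ?thesis unfolding b_def D_def .
qed

end
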